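(* Any two equivalent categories agree on homotopic sentences. That is, let $\mathbb C$ and $\mathbb D$ be equivalent categories, with respective iso-graphs $\mathbbm i\subseteq\mathbb C$ and $\mathbbm j\subseteq\mathbb D$. Then for every homotopic sentence $\sigma$ (without parameters), $\sigma$ holds in $\mathbb C$ (with the ternary predicate interpreted as $\mathrm{QC}_{\mathbbm i}$) if and only if $\sigma$ holds in $\mathbb D$ (with the ternary predicate interpreted as $\mathrm{QC}_{\mathbbm j}$).
   Context: Categories here have a set of objects and a set of morphisms. An iso-graph of a category $\mathbb C$ is a subcategory $\mathbbm i$ that is wide (same objects as $\mathbb C$) and thin (each hom-set has at most one element), such that $\mathrm{Hom}_{\mathbbm i}(A,B)\neq\emptyset$ if and only if $A\cong B$ in $\mathbb C$. (All morphisms of $\mathbbm i$ are then isomorphisms; iso-graphs exist by the axiom of choice.) Given an iso-graph $\mathbbm i$ and morphisms $f\colon A\to B$, $g\colon C\to D$, $h\colon P\to Q$ of $\mathbb C$, the predicate $\mathrm{QC}_{\mathbbm i}(f,g,h)$ (quasi-composition) holds if there exist $\mathbbm i$-morphisms $\alpha\colon P\to A$, $\gamma\colon B\to C$, $\delta\colon Q\to D$ such that $\delta\circ h=g\circ\gamma\circ f\circ\alpha$. A homotopic formula is a first-order formula, with variables ranging over the morphisms of the category, built from atomic formulas $\mathrm{QC}(x,y,z)$ using Boolean combinations and (unrestricted) quantification; equality is not allowed. A homotopic sentence is a homotopic formula without free variables. *)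

theory Defs
  imports Main
begin

section \<open>Categories\<close>

text \<open>\<open>Comp C g f\<close> is the composite \<open>g \<circ> f\<close>. The fields are only meaningful on the
  sets of objects and morphisms, hence the relativised axioms below.\<close>

record ('o, 'm) cat =
  Obj :: "'o set"
  Mor :: "'m set"
  Dom :: "'m \<Rightarrow> 'o"
  Cod :: "'m \<Rightarrow> 'o"
  Id :: "'o \<Rightarrow> 'm"
  Comp :: "'m \<Rightarrow> 'm \<Rightarrow> 'm"

definition Hom :: "('o, 'm) cat \<Rightarrow> 'o \<Rightarrow> 'o \<Rightarrow> 'm set" where
  "Hom C A B = {f \<in> Mor C. Dom C f = A \<and> Cod C f = B}"

locale category =
  fixes C :: "('o, 'm) cat"
  assumes Dom_in_Obj: "f \<in> Mor C \<Longrightarrow> Dom C f \<in> Obj C"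
    and Cod_in_Obj: "f \<in> Mor C \<Longrightarrow> Cod C f \<in> Obj C"
    and Id_in_Hom: "A \<in> Obj C \<Longrightarrow> Id C A \<in> Hom C A A"
    and Comp_in_Hom: "f \<in> Hom C A B \<Longrightarrow> g \<in> Hom C B D \<Longrightarrow> Comp C g f \<in> Hom C A D"
    and Comp_Id: "f \<in> Hom C A B \<Longrightarrow> Comp C f (Id C A) = f"
    and Id_Comp: "f \<in> Hom C A B \<Longrightarrow> Comp C (Id C B) f = f"
    and Comp_assoc: "f \<in> Hom C A B \<Longrightarrow> g \<in> Hom C B D \<Longrightarrow> h \<in> Hom C D E \<Longrightarrow>
      Comp C h (Comp C g f) = Comp C (Comp C h g) f"

definition iso_mor :: "('o, 'm) cat \<Rightarrow> 'm \<Rightarrow> bool" where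
  "iso_mor C f \<longleftrightarrow> f \<in> Mor C \<and>
    (\<exists>g \<in> Hom C (Cod C f) (Dom C f).
       Comp C g f = Id C (Dom C f) \<and> Comp C f g = Id C (Cod C f))"

definition isomorphic :: "('o, 'm) cat \<Rightarrow> 'o \<Rightarrow> 'o \<Rightarrow> bool" where
  "isomorphic C A B \<longleftrightarrow> (\<exists>f \<in> Hom C A B. iso_mor C f)"


section \<open>Equivalence of categories\<close>

record ('o, 'm, 'p, 'n) functor_data =
  onObj :: "'o \<Rightarrow> 'p"
  onMor :: "'m \<Rightarrow> 'n"

definition is_functor ::
  "('o, 'm) cat \<Rightarrow> ('p, 'n) cat \<Rightarrow> ('o, 'm, 'p, 'n) functor_data \<Rightarrow> bool" where
  "is_functor C D F \<longleftrightarrow>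
    (\<forall>A \<in> Obj C. onObj F A \<in> Obj D) \<and>
    (\<forall>A \<in> Obj C. \<forall>B \<in> Obj C. \<forall>f \<in> Hom C A B. onMor F f \<in> Hom D (onObj F A) (onObj F B)) \<and>
    (\<forall>A \<in> Obj C. onMor F (Id C A) = Id D (onObj F A)) \<and>
    (\<forall>f \<in> Mor C. \<forall>g \<in> Mor C. Cod C f = Dom C g \<longrightarrow>
       onMor F (Comp C g f) = Comp D (onMor F g) (onMor F f))"

definition id_functor :: "('o, 'm, 'o, 'm) functor_data" where
  "id_functor = \<lparr>onObj = (\<lambda>A. A), onMor = (\<lambda>f. f)\<rparr>"

definition comp_functor ::
  "('p, 'n, 'q, 'k) functor_data \<Rightarrow> ('o, 'm, 'p, 'n) functor_data \<Rightarrow>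
   ('o, 'm, 'q, 'k) functor_data" where
  "comp_functor G F =
    \<lparr>onObj = (\<lambda>A. onObj G (onObj F A)), onMor = (\<lambda>f. onMor G (onMor F f))\<rparr>"

definition natural_iso ::
  "('o, 'm) cat \<Rightarrow> ('p, 'n) cat \<Rightarrow> ('o, 'm, 'p, 'n) functor_data \<Rightarrow>
   ('o, 'm, 'p, 'n) functor_data \<Rightarrow> ('o \<Rightarrow> 'n) \<Rightarrow> bool" where
  "natural_iso C D F G t \<longleftrightarrow>
    (\<forall>A \<in> Obj C. t A \<in> Hom D (onObj F A) (onObj G A) \<and> iso_mor D (t A)) \<and>
    (\<forall>f \<in> Mor C. Comp D (t (Cod C f)) (onMor F f) = Comp D (onMor G f) (t (Dom C f)))"

definition equivalent_categories :: "('o, 'm) cat \<Rightarrow> ('p, 'n) cat \<Rightarrow> bool" where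
  "equivalent_categories C D \<longleftrightarrow>
    (\<exists>F G. is_functor C D F \<and> is_functor D C G \<and>
       (\<exists>\<eta>. natural_iso C C id_functor (comp_functor G F) \<eta>) \<and>
       (\<exists>\<epsilon>. natural_iso D D (comp_functor F G) id_functor \<epsilon>))"


section \<open>Iso-graphs and quasi-composition\<close>

text \<open>A subcategory is given by its sets of objects and morphisms; the remaining
  structure is inherited.\<close>

definition subcategory :: "('o, 'm) cat \<Rightarrow> 'o set \<Rightarrow> 'm set \<Rightarrow> bool" where
  "subcategory C S I \<longleftrightarrow>
    S \<subseteq> Obj C \<and> I \<subseteq> Mor C \<and>
    (\<forall>f \<in> I. Dom C f \<in> S \<and> Cod C f \<in> S) \<and>
    (\<forall>A \<in> S. Id C A \<in> I) \<and>
    (\<forall>f \<in> I. \<forall>g \<in> I. Cod C f = Dom C g \<longrightarrow> Comp C g f \<in> I)"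

text \<open>Since an iso-graph is wide, it is determined by its set \<open>I\<close> of morphisms, and its
  hom-sets are \<open>I \<inter> Hom C A B\<close>.\<close>

definition iso_graph :: "('o, 'm) cat \<Rightarrow> 'm set \<Rightarrow> bool" where
  "iso_graph C I \<longleftrightarrow>
    subcategory C (Obj C) I \<and>
    (\<forall>A \<in> Obj C. \<forall>B \<in> Obj C. \<forall>f \<in> I \<inter> Hom C A B. \<forall>g \<in> I \<inter> Hom C A B. f = g) \<and>
    (\<forall>A \<in> Obj C. \<forall>B \<in> Obj C. I \<inter> Hom C A B \<noteq> {} \<longleftrightarrow> isomorphic C A B)"

definition QC :: "('o, 'm) cat \<Rightarrow> 'm set \<Rightarrow> 'm \<Rightarrow> 'm \<Rightarrow> 'm \<Rightarrow> bool" where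
  "QC C I f g h \<longleftrightarrow>
    (\<exists>\<alpha> \<in> I \<inter> Hom C (Dom C h) (Dom C f).
     \<exists>\<gamma> \<in> I \<inter> Hom C (Cod C f) (Dom C g).
     \<exists>\<delta> \<in> I \<inter> Hom C (Cod C h) (Cod C g).
       Comp C \<delta> h = Comp C g (Comp C \<gamma> (Comp C f \<alpha>)))"


section \<open>Homotopic formulas\<close>

datatype hform =
    Atom nat nat nat
  | Neg hform
  | Conj hform hform
  | Disj hform hform
  | Impl hform hform
  | Iff hform hform
  | Forall nat hform
  | Exists nat hform

primrec free_vars :: "hform \<Rightarrow> nat set" where
  "free_vars (Atom x y z) = {x, y, z}"
| "free_vars (Neg \<phi>) = free_vars \<phi>"
| "free_vars (Conj \<phi> \<psi>) = free_vars \<phi> \<union> free_vars \<psi>"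
| "free_vars (Disj \<phi> \<psi>) = free_vars \<phi> \<union> free_vars \<psi>"
| "free_vars (Impl \<phi> \<psi>) = free_vars \<phi> \<union> free_vars \<psi>"
| "free_vars (Iff \<phi> \<psi>) = free_vars \<phi> \<union> free_vars \<psi>"
| "free_vars (Forall x \<phi>) = free_vars \<phi> - {x}"
| "free_vars (Exists x \<phi>) = free_vars \<phi> - {x}"

definition homotopic_sentence :: "hform \<Rightarrow> bool" where
  "homotopic_sentence \<phi> \<longleftrightarrow> free_vars \<phi> = {}"

primrec sat :: "'m set \<Rightarrow> ('m \<Rightarrow> 'm \<Rightarrow> 'm \<Rightarrow> bool) \<Rightarrow> (nat \<Rightarrow> 'm) \<Rightarrow> hform \<Rightarrow> bool" where
  "sat M R v (Atom x y z) \<longleftrightarrow> R (v x) (v y) (v z)"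
| "sat M R v (Neg \<phi>) \<longleftrightarrow> \<not> sat M R v \<phi>"
| "sat M R v (Conj \<phi> \<psi>) \<longleftrightarrow> sat M R v \<phi> \<and> sat M R v \<psi>"
| "sat M R v (Disj \<phi> \<psi>) \<longleftrightarrow> sat M R v \<phi> \<or> sat M R v \<psi>"
| "sat M R v (Impl \<phi> \<psi>) \<longleftrightarrow> (sat M R v \<phi> \<longrightarrow> sat M R v \<psi>)"
| "sat M R v (Iff \<phi> \<psi>) \<longleftrightarrow> (sat M R v \<phi> \<longleftrightarrow> sat M R v \<psi>)"
| "sat M R v (Forall x \<phi>) \<longleftrightarrow> (\<forall>a \<in> M. sat M R (v(x := a)) \<phi>)"
| "sat M R v (Exists x \<phi>) \<longleftrightarrow> (\<exists>a \<in> M. sat M R (v(x := a)) \<phi>)"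

lemma sat_cong_free_vars:
  "(\<And>x. x \<in> free_vars \<phi> \<Longrightarrow> v x = w x) \<Longrightarrow> sat M R v \<phi> = sat M R w \<phi>"
proof (induction \<phi> arbitrary: v w)
  case (Neg \<phi>)
  have "sat M R v \<phi> = sat M R w \<phi>" by (rule Neg.IH) (simp add: Neg.prems)
  then show ?case by simp
next
  case (Conj \<phi> \<psi>)
  have "sat M R v \<phi> = sat M R w \<phi>" by (rule Conj.IH) (simp add: Conj.prems)
  moreover have "sat M R v \<psi> = sat M R w \<psi>" by (rule Conj.IH) (simp add: Conj.prems)
  ultimately show ?case by simp
next
  case (Disj \<phi> \<psi>)
  have "sat M R v \<phi> = sat M R w \<phi>" by (rule Disj.IH) (simp add: Disj.prems)
  moreover have "sat M R v \<psi> = sat M R w \<psi>" by (rule Disj.IH) (simp add: Disj.prems)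
  ultimately show ?case by simp
next
  case (Impl \<phi> \<psi>)
  have "sat M R v \<phi> = sat M R w \<phi>" by (rule Impl.IH) (simp add: Impl.prems)
  moreover have "sat M R v \<psi> = sat M R w \<psi>" by (rule Impl.IH) (simp add: Impl.prems)
  ultimately show ?case by simp
next
  case (Iff \<phi> \<psi>)
  have "sat M R v \<phi> = sat M R w \<phi>" by (rule Iff.IH) (simp add: Iff.prems)
  moreover have "sat M R v \<psi> = sat M R w \<psi>" by (rule Iff.IH) (simp add: Iff.prems)
  ultimately show ?case by simp
next
  case (Forall x \<phi>)
  have "sat M R (v(x := a)) \<phi> = sat M R (w(x := a)) \<phi>" for a
    by (rule Forall.IH) (simp add: Forall.prems)
  then show ?case by simp
next
  case (Exists x \<phi>)
  have "sat M R (v(x := a)) \<phi> = sat M R (w(x := a)) \<phi>" for a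
    by (rule Exists.IH) (simp add: Exists.prems)
  then show ?case by simp
qed simp

text \<open>The valuation is not required to take values in the set of morphisms: truth of a
  sentence does not depend on it (\<open>sat_cong_free_vars\<close>), and the requirement would make
  every sentence hold in the empty category.\<close>

definition holds_in :: "('o, 'm) cat \<Rightarrow> 'm set \<Rightarrow> hform \<Rightarrow> bool" where
  "holds_in C I \<phi> \<longleftrightarrow> (\<forall>v. sat (Mor C) (QC C I) v \<phi>)"

end

theory Submission
  imports Defs
begin

text \<open>A homotopic sentence cannot tell apart two structures linked by a relation that is total on
  both sides and respects the predicate. Such a relation arises from an equivalence \<open>F\<close> and
  a coherent family of isomorphisms \<open>\<theta> A X\<close> from \<open>F A\<close> to \<open>X\<close>, one for each pair with
  \<open>F A \<cong> X\<close>, that is compatible with both iso-graphs: relate \<open>f\<close> to \<open>k\<close> if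
  \<open>\<theta> \<circ> F f = k \<circ> \<theta>\<close>. The family is obtained by choosing a representative in every isomorphism
  class of objects of \<open>C\<close> and passing through it along the iso-graph.\<close>

section \<open>Transfer of truth along a relation\<close>

text \<open>Induction on the formula. In the quantifier cases an element of one domain is matched by
  a related element of the other, and the updated valuations stay related. \<open>T\<close> may
  relate one element to many, because formulas cannot express equality.\<close>

lemma sat_transfer:
  assumes total: "\<And>a. a \<in> M \<Longrightarrow> \<exists>b \<in> N. T a b"
    and onto: "\<And>b. b \<in> N \<Longrightarrow> \<exists>a \<in> M. T a b"
    and rel: "\<And>a b c a' b' c'. T a a' \<Longrightarrow> T b b' \<Longrightarrow> T c c' \<Longrightarrow> R a b c \<longleftrightarrow> S a' b' c'"
  shows "(\<And>x. x \<in> free_vars \<phi> \<Longrightarrow> T (v x) (w x)) \<Longrightarrow> sat M R v \<phi> \<longleftrightarrow> sat N S w \<phi>"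
proof (induction \<phi> arbitrary: v w)
  case (Atom x y z)
  then show ?case by (simp add: rel)
next
  case (Forall x \<phi>)
  have "sat M R (v(x := a)) \<phi> \<longleftrightarrow> sat N S (w(x := b)) \<phi>" if "T a b" for a b
    by (rule Forall.IH) (use Forall.prems that in auto)
  then show ?case using total onto by (metis sat.simps(7))
next
  case (Exists x \<phi>)
  have "sat M R (v(x := a)) \<phi> \<longleftrightarrow> sat N S (w(x := b)) \<phi>" if "T a b" for a b
    by (rule Exists.IH) (use Exists.prems that in auto)
  then show ?case using total onto by (metis sat.simps(8))
next
  case (Neg \<phi>)
  show ?case using Neg.IH[of v w] Neg.prems by simp
next
  case (Conj \<phi> \<psi>)
  show ?case using Conj.IH[of v w] Conj.prems by simp
next
  case (Disj \<phi> \<psi>)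
  show ?case using Disj.IH[of v w] Disj.prems by simp
next
  case (Impl \<phi> \<psi>)
  show ?case using Impl.IH[of v w] Impl.prems by simp
next
  case (Iff \<phi> \<psi>)
  show ?case using Iff.IH[of v w] Iff.prems by simp
qed

section \<open>Composition and isomorphisms in a category\<close>

lemma in_Hom_iff: "f \<in> Hom C A B \<longleftrightarrow> f \<in> Mor C \<and> Dom C f = A \<and> Cod C f = B"
  by (simp add: Hom_def)

context category
begin

lemma Id_simps [simp]:
  assumes "A \<in> Obj C"
  shows "Id C A \<in> Mor C" "Dom C (Id C A) = A" "Cod C (Id C A) = A"
  using Id_in_Hom[OF assms] by (simp_all add: in_Hom_iff)

lemma Comp_simps [simp]:
  assumes "f \<in> Mor C" "g \<in> Mor C" "Cod C f = Dom C g"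
  shows "Comp C g f \<in> Mor C" "Dom C (Comp C g f) = Dom C f" "Cod C (Comp C g f) = Cod C g"
  using Comp_in_Hom[of f "Dom C f" "Cod C f" g "Cod C g"] assms by (simp_all add: in_Hom_iff)

lemma Comp_Id' [simp]: "f \<in> Mor C \<Longrightarrow> A = Dom C f \<Longrightarrow> Comp C f (Id C A) = f"
  using Comp_Id by (simp add: in_Hom_iff)

lemma Id_Comp' [simp]: "f \<in> Mor C \<Longrightarrow> A = Cod C f \<Longrightarrow> Comp C (Id C A) f = f"
  using Id_Comp by (simp add: in_Hom_iff)

lemma Comp_assoc':
  "f \<in> Mor C \<Longrightarrow> g \<in> Mor C \<Longrightarrow> h \<in> Mor C \<Longrightarrow> Cod C f = Dom C g \<Longrightarrow> Cod C g = Dom C h \<Longrightarrow>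
    Comp C (Comp C h g) f = Comp C h (Comp C g f)"
  using Comp_assoc by (simp add: in_Hom_iff)

lemma iso_morI:
  "f \<in> Mor C \<Longrightarrow> g \<in> Mor C \<Longrightarrow> Dom C g = Cod C f \<Longrightarrow> Cod C g = Dom C f \<Longrightarrow>
    Comp C g f = Id C (Dom C f) \<Longrightarrow> Comp C f g = Id C (Cod C f) \<Longrightarrow> iso_mor C f"
  by (auto simp: iso_mor_def in_Hom_iff)

lemma iso_morE:
  assumes "iso_mor C f"
  obtains g where "f \<in> Mor C" "g \<in> Mor C" "Dom C g = Cod C f" "Cod C g = Dom C f"
    "Comp C g f = Id C (Dom C f)" "Comp C f g = Id C (Cod C f)" "iso_mor C g"
proof -
  from assms obtain g where g: "f \<in> Mor C" "g \<in> Mor C" "Dom C g = Cod C f" "Cod C g = Dom C f"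
    "Comp C g f = Id C (Dom C f)" "Comp C f g = Id C (Cod C f)"
    by (auto simp: iso_mor_def in_Hom_iff)
  moreover from this have "iso_mor C g"
    by (intro iso_morI[of g f]) simp_all
  ultimately show thesis by (rule that)
qed

lemma iso_mor_Comp:
  assumes "iso_mor C f" "iso_mor C g" "Cod C f = Dom C g"
  shows "iso_mor C (Comp C g f)"
proof -
  from assms(1) obtain f' where f: "f \<in> Mor C" "f' \<in> Mor C" "Dom C f' = Cod C f"
    "Cod C f' = Dom C f" "Comp C f' f = Id C (Dom C f)" "Comp C f f' = Id C (Cod C f)"
    by (rule iso_morE)
  from assms(2) obtain g' where g: "g \<in> Mor C" "g' \<in> Mor C" "Dom C g' = Cod C g"
    "Cod C g' = Dom C g" "Comp C g' g = Id C (Dom C g)" "Comp C g g' = Id C (Cod C g)"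
    by (rule iso_morE)
  have "Comp C g' (Comp C g f) = f"
    using f g assms(3) by (simp flip: Comp_assoc')
  moreover have "Comp C f (Comp C f' g') = g'"
    using f g assms(3) by (simp flip: Comp_assoc')
  ultimately show ?thesis
    using f g assms(3) by (intro iso_morI[where g = "Comp C f' g'"]) (simp_all add: Comp_assoc')
qed

lemma iso_mor_cancel_left:
  assumes "Comp C m f = Comp C m f'" and "iso_mor C m" and "f \<in> Mor C" "f' \<in> Mor C"
    and "Cod C f = Dom C m" "Cod C f' = Dom C m"
  shows "f = f'"
proof -
  from assms(2) obtain n where n: "m \<in> Mor C" "n \<in> Mor C" "Dom C n = Cod C m"
    "Comp C n m = Id C (Dom C m)" by (rule iso_morE)
  have "Comp C (Comp C n m) f = Comp C (Comp C n m) f'"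
    using n(1-3) assms by (simp add: Comp_assoc')
  then show ?thesis using n assms by simp
qed

lemma iso_mor_cancel_right:
  assumes "Comp C f m = Comp C f' m" and "iso_mor C m" and "f \<in> Mor C" "f' \<in> Mor C"
    and "Dom C f = Cod C m" "Dom C f' = Cod C m"
  shows "f = f'"
proof -
  from assms(2) obtain n where n: "m \<in> Mor C" "n \<in> Mor C" "Cod C n = Dom C m"
    "Dom C n = Cod C m" "Comp C m n = Id C (Cod C m)" by (rule iso_morE)
  have "Comp C f (Comp C m n) = Comp C f' (Comp C m n)"
    using n(1-4) assms by (simp flip: Comp_assoc')
  then show ?thesis using n assms by simp
qed

lemma isomorphicI:
  "iso_mor C f \<Longrightarrow> Dom C f = A \<Longrightarrow> Cod C f = B \<Longrightarrow> isomorphic C A B"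
  by (auto simp: isomorphic_def in_Hom_iff iso_mor_def)

lemma isomorphicE:
  assumes "isomorphic C A B"
  obtains f where "iso_mor C f" "f \<in> Mor C" "Dom C f = A" "Cod C f = B"
  using assms by (auto simp: isomorphic_def in_Hom_iff)

lemma isomorphic_Obj: "isomorphic C A B \<Longrightarrow> A \<in> Obj C \<and> B \<in> Obj C"
  by (elim isomorphicE) (auto simp: Dom_in_Obj Cod_in_Obj)

lemma isomorphic_refl: "A \<in> Obj C \<Longrightarrow> isomorphic C A A"
  by (rule isomorphicI[of "Id C A"]) (auto intro: iso_morI[where g = "Id C A"])

lemma isomorphic_sym:
  assumes "isomorphic C A B" shows "isomorphic C B A"
proof -
  from assms obtain f where f: "iso_mor C f" "Dom C f = A" "Cod C f = B" by (rule isomorphicE)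
  from f(1) obtain g where "Dom C g = Cod C f" "Cod C g = Dom C f" "iso_mor C g"
    by (rule iso_morE)
  then show ?thesis using f by (intro isomorphicI[of g]) simp_all
qed

lemma isomorphic_trans:
  assumes "isomorphic C A B" "isomorphic C B D" shows "isomorphic C A D"
proof -
  from assms(1) obtain f where f: "iso_mor C f" "f \<in> Mor C" "Dom C f = A" "Cod C f = B"
    by (rule isomorphicE)
  from assms(2) obtain g where g: "iso_mor C g" "g \<in> Mor C" "Dom C g = B" "Cod C g = D"
    by (rule isomorphicE)
  show ?thesis
    using f g by (intro isomorphicI[of "Comp C g f"] iso_mor_Comp) simp_all
qed

end

section \<open>The morphisms of an iso-graph and representatives of isomorphism classes\<close>

locale iso_graph_category = category C for C :: "('o, 'm) cat" +
  fixes I :: "'m set"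
  assumes iso_graph: "iso_graph C I"
begin

text \<open>Thinness gives uniqueness, so for isomorphic objects this names the only possible
  morphism of \<open>I\<close>. For other pairs of objects the value is unspecified.\<close>

definition link :: "'o \<Rightarrow> 'o \<Rightarrow> 'm" where
  "link A B = (THE m. m \<in> I \<inter> Hom C A B)"

lemma link_unique: "A \<in> Obj C \<Longrightarrow> B \<in> Obj C \<Longrightarrow> m \<in> I \<inter> Hom C A B \<Longrightarrow> link A B = m"
  using iso_graph unfolding link_def iso_graph_def by blast

lemma link_mem:
  assumes "isomorphic C A B" shows "link A B \<in> I \<inter> Hom C A B"
proof -
  have "A \<in> Obj C" "B \<in> Obj C" using isomorphic_Obj[OF assms] by auto
  moreover from this assms obtain m where "m \<in> I \<inter> Hom C A B"
    using iso_graph unfolding iso_graph_def by blast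
  ultimately show ?thesis using link_unique by metis
qed

lemma link_simps [simp]:
  assumes "isomorphic C A B"
  shows "link A B \<in> Mor C" "Dom C (link A B) = A" "Cod C (link A B) = B"
  using link_mem[OF assms] by (simp_all add: in_Hom_iff)

lemma link_Comp:
  assumes "isomorphic C A B" "isomorphic C B D"
  shows "Comp C (link B D) (link A B) = link A D"
proof -
  have "Comp C (link B D) (link A B) \<in> I"
    using iso_graph link_mem[OF assms(1)] link_mem[OF assms(2)]
    by (auto simp: iso_graph_def subcategory_def in_Hom_iff)
  then show ?thesis
    using assms isomorphic_Obj by (intro link_unique[symmetric]) (auto simp: in_Hom_iff)
qed

lemma link_refl: "A \<in> Obj C \<Longrightarrow> link A A = Id C A"
  using iso_graph by (intro link_unique) (auto simp: in_Hom_iff iso_graph_def subcategory_def)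

text \<open>The inverse is the link in the opposite direction: both composites lie in
  \<open>I\<close> and are parallel to identities, so thinness makes them identities.\<close>

lemma iso_mor_link:
  assumes "isomorphic C A B" shows "iso_mor C (link A B)"
  using assms isomorphic_sym[OF assms] isomorphic_Obj[OF assms]
  by (intro iso_morI[where g = "link B A"]) (simp_all add: link_Comp link_refl)

lemma mem_iff_link:
  "A \<in> Obj C \<Longrightarrow> B \<in> Obj C \<Longrightarrow> m \<in> I \<inter> Hom C A B \<longleftrightarrow> isomorphic C A B \<and> m = link A B"
  using iso_graph link_unique link_mem unfolding iso_graph_def by blast

text \<open>Each of the three existential quantifiers ranges over a set with at most one element,
  the link, which is nonempty exactly when the objects are isomorphic. Quasi-composition thus splits
  into isomorphism conditions and one equation, which can be transported separately.\<close>

lemma QC_iff: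
  assumes "f \<in> Mor C" "g \<in> Mor C" "h \<in> Mor C"
  shows "QC C I f g h \<longleftrightarrow>
    isomorphic C (Dom C h) (Dom C f) \<and> isomorphic C (Cod C f) (Dom C g) \<and>
    isomorphic C (Cod C h) (Cod C g) \<and>
    Comp C (link (Cod C h) (Cod C g)) h =
      Comp C g (Comp C (link (Cod C f) (Dom C g)) (Comp C f (link (Dom C h) (Dom C f))))"
  using assms by (simp add: QC_def Bex_def mem_iff_link Dom_in_Obj Cod_in_Obj del: Int_iff) blast

definition rep :: "'o \<Rightarrow> 'o" where
  "rep A = (SOME B. isomorphic C A B)"

lemma isomorphic_rep: "A \<in> Obj C \<Longrightarrow> isomorphic C A (rep A)"
  unfolding rep_def by (rule someI) (rule isomorphic_refl)

text \<open>The choice in \<open>rep\<close> depends only on the predicate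
  \<open>isomorphic C A\<close>, and isomorphic objects have the same predicate. The representatives
  are therefore equal, not merely isomorphic.\<close>

lemma rep_eq:
  assumes "isomorphic C A B" shows "rep A = rep B"
proof -
  have "isomorphic C A = isomorphic C B"
    using assms isomorphic_sym isomorphic_trans by blast
  then show ?thesis by (simp add: rep_def)
qed

end

section \<open>Functors\<close>

locale category_functor = C: category C + D: category D
  for C :: "('o, 'm) cat" and D :: "('p, 'n) cat" +
  fixes F :: "('o, 'm, 'p, 'n) functor_data"
  assumes is_functor: "is_functor C D F"
begin

lemma onObj_in [simp]: "A \<in> Obj C \<Longrightarrow> onObj F A \<in> Obj D"
  using is_functor by (simp add: is_functor_def)

lemma onMor_simps [simp]:
  assumes "f \<in> Mor C"
  shows "onMor F f \<in> Mor D" "Dom D (onMor F f) = onObj F (Dom C f)"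
    "Cod D (onMor F f) = onObj F (Cod C f)"
proof -
  have "f \<in> Hom C (Dom C f) (Cod C f)" using assms by (simp add: in_Hom_iff)
  then have "onMor F f \<in> Hom D (onObj F (Dom C f)) (onObj F (Cod C f))"
    using is_functor C.Dom_in_Obj[OF assms] C.Cod_in_Obj[OF assms] unfolding is_functor_def by blast
  then show "onMor F f \<in> Mor D" "Dom D (onMor F f) = onObj F (Dom C f)"
    "Cod D (onMor F f) = onObj F (Cod C f)" by (simp_all add: in_Hom_iff)
qed

lemma onMor_Id: "A \<in> Obj C \<Longrightarrow> onMor F (Id C A) = Id D (onObj F A)"
  using is_functor by (simp add: is_functor_def)

lemma onMor_Comp:
  "f \<in> Mor C \<Longrightarrow> g \<in> Mor C \<Longrightarrow> Cod C f = Dom C g \<Longrightarrow>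
    onMor F (Comp C g f) = Comp D (onMor F g) (onMor F f)"
  using is_functor by (simp add: is_functor_def)

lemma iso_mor_onMor:
  assumes "iso_mor C f" shows "iso_mor D (onMor F f)"
proof -
  from assms obtain g where g: "f \<in> Mor C" "g \<in> Mor C" "Dom C g = Cod C f" "Cod C g = Dom C f"
    "Comp C g f = Id C (Dom C f)" "Comp C f g = Id C (Cod C f)" by (rule C.iso_morE)
  then show ?thesis
    by (intro D.iso_morI[where g = "onMor F g"])
      (simp_all add: C.Dom_in_Obj C.Cod_in_Obj flip: onMor_Id onMor_Comp)
qed

lemma isomorphic_onObj: "isomorphic C A B \<Longrightarrow> isomorphic D (onObj F A) (onObj F B)"
  by (elim C.isomorphicE) (auto intro: D.isomorphicI iso_mor_onMor)

end

section \<open>The relation between morphisms induced by an equivalence\<close>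

text \<open>The inverse functor is absent: only properties of \<open>F\<close> enter the
  construction. Fullness and essential surjectivity make the relation onto, \<open>faithful\<close>
  lets it respect equations, and \<open>reflect\<close> lets it respect isomorphism of
  objects.\<close>

locale iso_graph_equivalence =
  category_functor C D F + C: iso_graph_category C I + D: iso_graph_category D J
  for C :: "('o, 'm) cat" and I :: "'m set" and D :: "('p, 'n) cat" and J :: "'n set"
    and F :: "('o, 'm, 'p, 'n) functor_data" +
  assumes faithful: "f \<in> Hom C A B \<Longrightarrow> f' \<in> Hom C A B \<Longrightarrow> onMor F f = onMor F f' \<Longrightarrow> f = f'"
    and full: "A \<in> Obj C \<Longrightarrow> B \<in> Obj C \<Longrightarrow> k \<in> Hom D (onObj F A) (onObj F B) \<Longrightarrow>
      \<exists>f \<in> Hom C A B. onMor F f = k"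
    and ess_surj: "X \<in> Obj D \<Longrightarrow> \<exists>A \<in> Obj C. isomorphic D (onObj F A) X"
    and reflect: "A \<in> Obj C \<Longrightarrow> B \<in> Obj C \<Longrightarrow> isomorphic D (onObj F A) (onObj F B) \<Longrightarrow>
      isomorphic C A B"
begin

text \<open>The direct choice \<open>D.link (onObj F A) X\<close> would not be compatible with
  \<open>I\<close>, since \<open>F\<close> need not map \<open>I\<close> into \<open>J\<close>. The
  detour through \<open>C.rep A\<close> lets the first factor absorb links of \<open>C\<close> and
  the second absorb links of \<open>D\<close>.\<close>

definition \<theta> :: "'o \<Rightarrow> 'p \<Rightarrow> 'n" where
  "\<theta> A X = Comp D (D.link (onObj F (C.rep A)) X) (onMor F (C.link A (C.rep A)))"

context
  fixes A :: 'o and X :: 'p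
  assumes A: "A \<in> Obj C" and AX: "isomorphic D (onObj F A) X"
begin

lemma isomorphic_rep_image: "isomorphic D (onObj F (C.rep A)) X"
  using A AX C.isomorphic_rep D.isomorphic_sym D.isomorphic_trans isomorphic_onObj by blast

lemma \<theta>_simps [simp]:
  "\<theta> A X \<in> Mor D" "Dom D (\<theta> A X) = onObj F A" "Cod D (\<theta> A X) = X"
  using C.isomorphic_rep[OF A] isomorphic_rep_image by (simp_all add: \<theta>_def)

lemma iso_mor_\<theta>: "iso_mor D (\<theta> A X)"
  unfolding \<theta>_def using C.isomorphic_rep[OF A] isomorphic_rep_image
  by (intro D.iso_mor_Comp iso_mor_onMor C.iso_mor_link D.iso_mor_link) simp_all

lemma \<theta>_link_right:
  assumes "isomorphic D X Y" shows "Comp D (D.link X Y) (\<theta> A X) = \<theta> A Y"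
  using assms C.isomorphic_rep[OF A] isomorphic_rep_image
  by (simp add: \<theta>_def D.link_Comp flip: D.Comp_assoc')

text \<open>Functoriality merges the two images of links into one, and \<open>B\<close> and
  \<open>A\<close> have the same representative, so the second factor is unchanged.\<close>

lemma \<theta>_link_left:
  assumes "isomorphic C B A" shows "Comp D (\<theta> A X) (onMor F (C.link B A)) = \<theta> B X"
  using assms C.isomorphic_rep[OF A] isomorphic_rep_image
  by (simp add: \<theta>_def C.link_Comp C.rep_eq[OF assms] D.Comp_assoc' flip: onMor_Comp)

end

text \<open>This is a relation and not a map: \<open>f\<close> has a partner between any two objects
  isomorphic to the images of its domain and codomain. This freedom lets it reach every morphism of
  \<open>D\<close>.\<close>

definition related :: "'m \<Rightarrow> 'n \<Rightarrow> bool" where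
  "related f k \<longleftrightarrow> f \<in> Mor C \<and> k \<in> Mor D \<and>
    isomorphic D (onObj F (Dom C f)) (Dom D k) \<and> isomorphic D (onObj F (Cod C f)) (Cod D k) \<and>
    Comp D (\<theta> (Cod C f) (Cod D k)) (onMor F f) = Comp D k (\<theta> (Dom C f) (Dom D k))"

lemma related_total:
  assumes f: "f \<in> Mor C" shows "\<exists>k \<in> Mor D. related f k"
proof -
  let ?s = "\<theta> (Dom C f) (onObj F (Dom C f))" and ?t = "\<theta> (Cod C f) (onObj F (Cod C f))"
  have ob: "Dom C f \<in> Obj C" "Cod C f \<in> Obj C"
    using f C.Dom_in_Obj C.Cod_in_Obj by auto
  then have r: "isomorphic D (onObj F (Dom C f)) (onObj F (Dom C f))"
    "isomorphic D (onObj F (Cod C f)) (onObj F (Cod C f))"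
    by (simp_all add: D.isomorphic_refl)
  obtain s where s: "s \<in> Mor D" "Dom D s = Cod D ?s" "Cod D s = Dom D ?s"
    "Comp D s ?s = Id D (Dom D ?s)"
    using iso_mor_\<theta>[OF ob(1) r(1)] by (rule D.iso_morE)
  \<comment> \<open>The partner is \<open>onMor F f\<close> conjugated by \<theta>, since
    \<open>\<theta> A (onObj F A)\<close> need not be an identity.\<close>
  have "related f (Comp D ?t (Comp D (onMor F f) s))"
    using f ob r s by (simp add: related_def D.Comp_assoc')
  then show ?thesis by (auto simp: related_def)
qed

lemma related_onto:
  assumes k: "k \<in> Mor D" shows "\<exists>f \<in> Mor C. related f k"
proof -
  obtain A where A: "A \<in> Obj C" "isomorphic D (onObj F A) (Dom D k)"
    using ess_surj k D.Dom_in_Obj by blast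
  obtain B where B: "B \<in> Obj C" "isomorphic D (onObj F B) (Cod D k)"
    using ess_surj k D.Cod_in_Obj by blast
  let ?s = "\<theta> A (Dom D k)" and ?t = "\<theta> B (Cod D k)"
  obtain t where t: "t \<in> Mor D" "Dom D t = Cod D ?t" "Cod D t = Dom D ?t"
    "Comp D ?t t = Id D (Cod D ?t)"
    using iso_mor_\<theta>[OF B] by (rule D.iso_morE)
  \<comment> \<open>Conjugating \<open>k\<close> back along \<theta> gives a morphism between
    objects in the image of \<open>F\<close>, where fullness applies.\<close>
  have "Comp D t (Comp D k ?s) \<in> Hom D (onObj F A) (onObj F B)"
    using k A B t by (simp add: in_Hom_iff)
  then obtain f where f: "f \<in> Hom C A B" "onMor F f = Comp D t (Comp D k ?s)"
    using full A B by blast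
  have "Comp D ?t (Comp D t (Comp D k ?s)) = Comp D k ?s"
    using k A B t by (simp flip: D.Comp_assoc')
  then have "related f k"
    using f k A B by (simp add: related_def in_Hom_iff)
  then show ?thesis by (auto simp: related_def)
qed

lemma isomorphic_transport:
  assumes "A \<in> Obj C" "B \<in> Obj C" "isomorphic D (onObj F A) X" "isomorphic D (onObj F B) Y"
  shows "isomorphic C A B \<longleftrightarrow> isomorphic D X Y"
  using assms reflect isomorphic_onObj D.isomorphic_sym D.isomorphic_trans by meson

text \<open>Both sides of the required square equal \<open>\<theta> A Y\<close>: one by
  \<open>\<theta>_link_left\<close>, the other by \<open>\<theta>_link_right\<close>.\<close>

lemma related_link:
  assumes "A \<in> Obj C" "B \<in> Obj C" "isomorphic D (onObj F A) X" "isomorphic D (onObj F B) Y"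
    and "isomorphic C A B"
  shows "related (C.link A B) (D.link X Y)"
proof -
  have XY: "isomorphic D X Y" using isomorphic_transport assms by blast
  show ?thesis
    using assms XY by (simp add: related_def \<theta>_link_left \<theta>_link_right)
qed

text \<open>Two commuting squares are pasted along the \<theta> at the shared middle
  objects.\<close>

lemma related_Comp:
  assumes "related f k" "related g l" "Cod C f = Dom C g" "Cod D k = Dom D l"
  shows "related (Comp C g f) (Comp D l k)"
proof -
  have f: "f \<in> Mor C" "k \<in> Mor D" "isomorphic D (onObj F (Dom C f)) (Dom D k)"
    "isomorphic D (onObj F (Cod C f)) (Cod D k)"
    and eqf: "Comp D (\<theta> (Cod C f) (Cod D k)) (onMor F f) = Comp D k (\<theta> (Dom C f) (Dom D k))"
    using assms(1) by (auto simp: related_def)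
  have g: "g \<in> Mor C" "l \<in> Mor D" "isomorphic D (onObj F (Cod C g)) (Cod D l)"
    and eqg: "Comp D (\<theta> (Cod C g) (Cod D l)) (onMor F g) = Comp D l (\<theta> (Dom C g) (Dom D l))"
    using assms(2) by (auto simp: related_def)
  note ob = C.Dom_in_Obj[OF f(1)] C.Cod_in_Obj[OF f(1)] C.Cod_in_Obj[OF g(1)]
  have "Comp D (\<theta> (Cod C g) (Cod D l)) (Comp D (onMor F g) (onMor F f)) =
      Comp D (Comp D (\<theta> (Cod C g) (Cod D l)) (onMor F g)) (onMor F f)"
    using f g ob assms(3,4) by (simp add: D.Comp_assoc')
  also have "\<dots> = Comp D l (Comp D (\<theta> (Cod C f) (Cod D k)) (onMor F f))"
    unfolding eqg using f g ob assms(3,4) by (simp add: D.Comp_assoc')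
  also have "\<dots> = Comp D (Comp D l k) (\<theta> (Dom C f) (Dom D k))"
    unfolding eqf using f g ob assms(3,4) by (simp add: D.Comp_assoc')
  finally show ?thesis
    using f g ob assms(3,4) by (simp add: related_def onMor_Comp)
qed

text \<open>The components of \<theta> are isomorphisms, so they cancel from the squares. This gives
  \<open>k = k'\<close> in one direction and equality of the images under \<open>F\<close> in the
  other, where faithfulness finishes.\<close>

lemma related_eq_iff:
  assumes "related f k" "related f' k'"
    and C: "Dom C f = Dom C f'" "Cod C f = Cod C f'" and D: "Dom D k = Dom D k'" "Cod D k = Cod D k'"
  shows "f = f' \<longleftrightarrow> k = k'"
proof -
  let ?s = "\<theta> (Dom C f) (Dom D k)" and ?t = "\<theta> (Cod C f) (Cod D k)"
  have m: "f \<in> Mor C" "f' \<in> Mor C" "k \<in> Mor D" "k' \<in> Mor D"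
    and i: "isomorphic D (onObj F (Dom C f)) (Dom D k)" "isomorphic D (onObj F (Cod C f)) (Cod D k)"
    and eq: "Comp D ?t (onMor F f) = Comp D k ?s" "Comp D ?t (onMor F f') = Comp D k' ?s"
    using assms by (auto simp: related_def)
  note ob = C.Dom_in_Obj[OF m(1)] C.Cod_in_Obj[OF m(1)]
  note t = iso_mor_\<theta>[OF ob(1) i(1)] iso_mor_\<theta>[OF ob(2) i(2)]
  show ?thesis
  proof
    assume "f = f'"
    then have "Comp D k ?s = Comp D k' ?s" using eq by simp
    from this t(1) show "k = k'"
      by (rule D.iso_mor_cancel_right) (use m i ob D in simp_all)
  next
    assume "k = k'"
    then have "Comp D ?t (onMor F f) = Comp D ?t (onMor F f')" using eq by simp
    from this t(2) have "onMor F f = onMor F f'"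
      by (rule D.iso_mor_cancel_left) (use m i ob C in simp_all)
    then show "f = f'" using faithful m C by (simp add: in_Hom_iff)
  qed
qed

lemma related_QC_iff:
  assumes rel: "related f f'" "related g g'" "related h h'"
  shows "QC C I f g h \<longleftrightarrow> QC D J f' g' h'"
proof -
  have m: "f \<in> Mor C" "g \<in> Mor C" "h \<in> Mor C" "f' \<in> Mor D" "g' \<in> Mor D" "h' \<in> Mor D"
    and i: "isomorphic D (onObj F (Dom C f)) (Dom D f')" "isomorphic D (onObj F (Cod C f)) (Cod D f')"
      "isomorphic D (onObj F (Dom C g)) (Dom D g')" "isomorphic D (onObj F (Cod C g)) (Cod D g')"
      "isomorphic D (onObj F (Dom C h)) (Dom D h')" "isomorphic D (onObj F (Cod C h)) (Cod D h')"
    using rel by (auto simp: related_def)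
  note ob = C.Dom_in_Obj[OF m(1)] C.Cod_in_Obj[OF m(1)] C.Dom_in_Obj[OF m(2)]
    C.Cod_in_Obj[OF m(2)] C.Dom_in_Obj[OF m(3)] C.Cod_in_Obj[OF m(3)]
  \<comment> \<open>These are the three pairs of objects joined by \<alpha>, \<gamma> and \<delta>
    in the definition of \<open>QC\<close>, in this order.\<close>
  note tr = isomorphic_transport[OF ob(5,1) i(5,1)] isomorphic_transport[OF ob(2,3) i(2,3)]
    isomorphic_transport[OF ob(6,4) i(6,4)]
  have "Comp C (C.link (Cod C h) (Cod C g)) h =
      Comp C g (Comp C (C.link (Cod C f) (Dom C g)) (Comp C f (C.link (Dom C h) (Dom C f)))) \<longleftrightarrow>
    Comp D (D.link (Cod D h') (Cod D g')) h' =
      Comp D g' (Comp D (D.link (Cod D f') (Dom D g')) (Comp D f' (D.link (Dom D h') (Dom D f'))))"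
    if c: "isomorphic C (Dom C h) (Dom C f)" "isomorphic C (Cod C f) (Dom C g)"
      "isomorphic C (Cod C h) (Cod C g)"
  proof -
    have d: "isomorphic D (Dom D h') (Dom D f')" "isomorphic D (Cod D f') (Dom D g')"
      "isomorphic D (Cod D h') (Cod D g')"
      using c tr by auto
    show ?thesis
      \<comment> \<open>Each side of the equation in \<open>C\<close> is related to its counterpart
        in \<open>D\<close>, piece by piece: the given morphisms by hypothesis, the links by
        \<open>related_link\<close>.\<close>
      by (rule related_eq_iff; (intro related_Comp related_link rel)?) (use m i ob c d in simp_all)
  qed
  then show ?thesis
    unfolding C.QC_iff[OF m(1-3)] D.QC_iff[OF m(4-6)] using tr by blast
qed

lemma holds_in_iff:
  assumes "homotopic_sentence \<sigma>" shows "holds_in C I \<sigma> \<longleftrightarrow> holds_in D J \<sigma>"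
proof -
  \<comment> \<open>A sentence has no free variables, so the premise of \<open>sat_transfer\<close>
    on valuations is vacuous and \<open>v\<close>, \<open>w\<close> are arbitrary.\<close>
  have "sat (Mor C) (QC C I) v \<sigma> \<longleftrightarrow> sat (Mor D) (QC D J) w \<sigma>" for v w
    by (rule sat_transfer[where T = related])
      (use assms in \<open>auto simp: homotopic_sentence_def related_total related_onto related_QC_iff\<close>)
  then show ?thesis unfolding holds_in_def by blast
qed

end

section \<open>Properties of a functor that is part of an equivalence\<close>

text \<open>By naturality, \<open>Comp C (t B) f\<close> depends on \<open>f\<close> only through
  \<open>onMor F f\<close>, and the isomorphism \<open>t B\<close> cancels.\<close>

lemma faithful_if_left_inverse:
  assumes C: "category C" and t: "\<And>A. A \<in> Obj C \<Longrightarrow> iso_mor C (t A) \<and> Dom C (t A) = A"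
    and nat: "\<And>f. f \<in> Mor C \<Longrightarrow> Comp C (t (Cod C f)) f = Comp C (onMor G (onMor F f)) (t (Dom C f))"
    and f: "f \<in> Hom C A B" "f' \<in> Hom C A B" "onMor F f = onMor F f'"
  shows "f = f'"
proof -
  interpret category C by fact
  have B: "B \<in> Obj C" using f(1) Cod_in_Obj by (auto simp: in_Hom_iff)
  have "Comp C (t B) f = Comp C (t B) f'"
    using nat[of f] nat[of f'] f by (simp add: in_Hom_iff)
  then show ?thesis
    by (rule iso_mor_cancel_left) (use t[OF B] f in \<open>simp_all add: in_Hom_iff\<close>)
qed

text \<open>The mirror image, with cancellation on the right. It yields faithfulness of
  \<open>G\<close>, on which the fullness of \<open>F\<close> rests.\<close>

lemma faithful_if_right_inverse:
  assumes D: "category D" and t: "\<And>X. X \<in> Obj D \<Longrightarrow> iso_mor D (t X) \<and> Cod D (t X) = X"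
    and nat: "\<And>k. k \<in> Mor D \<Longrightarrow> Comp D (t (Cod D k)) (onMor F (onMor G k)) = Comp D k (t (Dom D k))"
    and k: "k \<in> Hom D X Y" "k' \<in> Hom D X Y" "onMor G k = onMor G k'"
  shows "k = k'"
proof -
  interpret category D by fact
  have X: "X \<in> Obj D" using k(1) Dom_in_Obj by (auto simp: in_Hom_iff)
  have "Comp D k (t X) = Comp D k' (t X)"
    using nat[of k] nat[of k'] k by (simp add: in_Hom_iff)
  then show ?thesis
    by (rule iso_mor_cancel_right) (use t[OF X] k in \<open>simp_all add: in_Hom_iff\<close>)
qed

lemma equivalence_imp_iso_graph_equivalence:
  assumes "category C" "category D" "iso_graph C I" "iso_graph D J"
    and F: "is_functor C D F" and G: "is_functor D C G"
    and \<eta>: "natural_iso C C id_functor (comp_functor G F) \<eta>"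
    and \<epsilon>: "natural_iso D D (comp_functor F G) id_functor \<epsilon>"
  shows "iso_graph_equivalence C I D J F"
proof -
  interpret C: iso_graph_category C I
    using assms by (simp add: iso_graph_category_def iso_graph_category_axioms_def)
  interpret D: iso_graph_category D J
    using assms by (simp add: iso_graph_category_def iso_graph_category_axioms_def)
  interpret F: category_functor C D F by unfold_locales fact
  interpret G: category_functor D C G by unfold_locales fact
  have \<eta>_iso: "iso_mor C (\<eta> A)" "\<eta> A \<in> Mor C" "Dom C (\<eta> A) = A" "Cod C (\<eta> A) = onObj G (onObj F A)"
    if "A \<in> Obj C" for A
    using \<eta> that by (auto simp: natural_iso_def id_functor_def comp_functor_def in_Hom_iff)
  have \<eta>_nat: "Comp C (\<eta> (Cod C f)) f = Comp C (onMor G (onMor F f)) (\<eta> (Dom C f))"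
    if "f \<in> Mor C" for f
    using \<eta> that by (auto simp: natural_iso_def id_functor_def comp_functor_def)
  have \<epsilon>_iso: "iso_mor D (\<epsilon> X)" "Dom D (\<epsilon> X) = onObj F (onObj G X)" "Cod D (\<epsilon> X) = X"
    if "X \<in> Obj D" for X
    using \<epsilon> that by (auto simp: natural_iso_def id_functor_def comp_functor_def in_Hom_iff)
  have \<epsilon>_nat: "Comp D (\<epsilon> (Cod D k)) (onMor F (onMor G k)) = Comp D k (\<epsilon> (Dom D k))"
    if "k \<in> Mor D" for k
    using \<epsilon> that by (auto simp: natural_iso_def id_functor_def comp_functor_def)
  have G_faithful: "k = k'" if "k \<in> Hom D X Y" "k' \<in> Hom D X Y" "onMor G k = onMor G k'" for k k' X Y
    by (rule faithful_if_right_inverse[OF assms(2) _ \<epsilon>_nat that]) (simp_all add: \<epsilon>_iso)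
  show ?thesis
  proof
    show "f = f'" if "f \<in> Hom C A B" "f' \<in> Hom C A B" "onMor F f = onMor F f'" for f f' A B
      by (rule faithful_if_left_inverse[OF assms(1) _ \<eta>_nat that]) (simp_all add: \<eta>_iso)
  next
    fix A B k
    assume A: "A \<in> Obj C" and B: "B \<in> Obj C" and k: "k \<in> Hom D (onObj F A) (onObj F B)"
    obtain n where n: "n \<in> Mor C" "Dom C n = Cod C (\<eta> B)" "Cod C n = B"
      "Comp C (\<eta> B) n = Id C (Cod C (\<eta> B))"
      using \<eta>_iso(1)[OF B] by (rule C.iso_morE) (use \<eta>_iso(3)[OF B] in simp)
    \<comment> \<open>The preimage of \<open>k\<close> is \<open>onMor G k\<close> conjugated by
      \<eta>, with \<open>n\<close> the inverse of \<open>\<eta> B\<close>. Naturality of \<eta>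
      then gives \<open>f\<close> and \<open>k\<close> the same image in \<open>C\<close>, and
      faithfulness of \<open>G\<close> concludes without any triangle identity between \<eta> and
      \<epsilon>.\<close>
    define f where "f = Comp C n (Comp C (onMor G k) (\<eta> A))"
    have f: "f \<in> Mor C" "Dom C f = A" "Cod C f = B"
      using k n \<eta>_iso[OF A] \<eta>_iso[OF B] by (simp_all add: f_def in_Hom_iff)
    have "Comp C (onMor G (onMor F f)) (\<eta> A) = Comp C (\<eta> B) f"
      using \<eta>_nat[of f] f by simp
    also have "\<dots> = Comp C (onMor G k) (\<eta> A)"
      using k n \<eta>_iso[OF A] \<eta>_iso[OF B] by (simp add: f_def in_Hom_iff flip: C.Comp_assoc')
    finally have "onMor G (onMor F f) = onMor G k"
      by (rule C.iso_mor_cancel_right)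
        (use f k \<eta>_iso[OF A] in \<open>simp_all add: in_Hom_iff\<close>)
    moreover have "onMor F f \<in> Hom D (onObj F A) (onObj F B)"
      using f by (simp add: in_Hom_iff)
    ultimately have "onMor F f = k"
      using k G_faithful by blast
    then show "\<exists>f \<in> Hom C A B. onMor F f = k"
      using f by (auto simp: in_Hom_iff)
  next
    show "\<exists>A \<in> Obj C. isomorphic D (onObj F A) X" if "X \<in> Obj D" for X
      using that D.isomorphicI[OF \<epsilon>_iso] by (intro bexI[of _ "onObj G X"]) simp_all
  next
    fix A B
    assume A: "A \<in> Obj C" and B: "B \<in> Obj C" and i: "isomorphic D (onObj F A) (onObj F B)"
    \<comment> \<open>\<open>G\<close> preserves the isomorphism \<open>i\<close>, and the
      components of \<eta> join its two ends to \<open>A\<close> and \<open>B\<close>.\<close>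
    have "isomorphic C A (onObj G (onObj F A))" "isomorphic C B (onObj G (onObj F B))"
      using A B \<eta>_iso C.isomorphicI by blast+
    then show "isomorphic C A B"
      using G.isomorphic_onObj[OF i] C.isomorphic_sym C.isomorphic_trans by blast
  qed
qed

theorem theorem9p5:
  fixes C :: "('o, 'm) cat" and D :: "('p, 'n) cat"
    and I :: "'m set" and J :: "'n set" and \<sigma> :: hform
  assumes "category C" and "category D"
    and "equivalent_categories C D"
    and "iso_graph C I" and "iso_graph D J"
    and "homotopic_sentence \<sigma>"
  shows "holds_in C I \<sigma> \<longleftrightarrow> holds_in D J \<sigma>"
proof -
  obtain F where "iso_graph_equivalence C I D J F"
    using assms(1-5) equivalence_imp_iso_graph_equivalence
    unfolding equivalent_categories_def by blast
  then show ?thesis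
    using assms(6) by (rule iso_graph_equivalence.holds_in_iff)
qed

end
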